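(* Let $G=K_{n_1,\dots,n_l}$ be the complete multipartite graph with parts $V_1,\dots,V_l$, $|V_p|=n_p\ge 1$. The number of simple travel groupoids on $G$ is equal to $$\prod_{p=1}^{l}\prod_{k=1}^{n_p}\ \sum_{S_p=n_p-k}\binom{n_p-k}{m_{1,1},\dots,m_{p-1,n_{p-1}},m_{p+1,1},\dots,m_{l,n_l}},$$ where, for each $p$, the lower indices are all $m_{q,j}$ with $q\in\{1,\dots,l\}\setminus\{p\}$ and $1\le j\le n_q$, the sum runs over all families of nonnegative integers $(m_{q,j})$ with $S_p=n_p-k$, and $$S_p=m_{1,1}+\cdots+m_{p-1,n_{p-1}}+m_{p+1,1}+\cdots+m_{l,n_l}=\sum_{q\ne p}\sum_{j=1}^{n_q}m_{q,j}.$$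
   Context: A groupoid $(V,* )$ is a nonempty set $V$ with a binary operation $*:V\times V\to V$. It is a travel groupoid if (t1) $(u*v)*u=u$ for all $u,v\in V$, and (t2) for all $u,v\in V$, if $(u*v)*v=u$ then $u=v$. A travel groupoid is simple if (t3) for all $u,v\in V$, if $v*u\neq u$, then $u*(v*u)=u*v$. The associated graph $G_V$ of a travel groupoid has vertex set $V$ and edge set $\{\{u,v\} : u,v\in V,\ u\neq u*v=v\}$; $(V,* )$ is said to be on a graph $G$ if $G=G_V$ (equality of graphs on the vertex set $V=V(G)$, so one counts binary operations on $V(G)$). Graphs are finite, undirected, with no multiple edges or loops. $K_{n_1,\dots,n_l}$ is the graph whose vertex set is partitioned into independent sets $V_1,\dots,V_l$ with $|V_i|=n_i\geq 1$, with an edge between every pair of vertices from different parts. The multinomial coefficient is $\binom{n}{a_1,\dots,a_k}=\frac{n!}{a_1!\cdots a_k!}$. *)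

theory Defs
  imports "HOL-Library.FuncSet" "HOL-Library.Disjoint_Sets"
begin

(* The carrier is an explicit set V.  The operation is required to be extensional
   (it is "undefined" outside V), so that each binary operation on V is represented
   by exactly one HOL function and operations can be counted with "card". *)
locale groupoid =
  fixes V :: "'a set" and f :: "'a \<Rightarrow> 'a \<Rightarrow> 'a" (infixl "\<star>" 70)
  assumes nonempty: "V \<noteq> {}"
    and op_closed: "f \<in> V \<rightarrow>\<^sub>E (V \<rightarrow>\<^sub>E V)"

locale travel_groupoid = groupoid +
  assumes t1: "\<And>u v. u \<in> V \<Longrightarrow> v \<in> V \<Longrightarrow> (u \<star> v) \<star> u = u"
    and t2: "\<And>u v. u \<in> V \<Longrightarrow> v \<in> V \<Longrightarrow> (u \<star> v) \<star> v = u \<Longrightarrow> u = v"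

locale simple_travel_groupoid = travel_groupoid +
  assumes t3: "\<And>u v. u \<in> V \<Longrightarrow> v \<in> V \<Longrightarrow> v \<star> u \<noteq> u \<Longrightarrow> u \<star> (v \<star> u) = u \<star> v"

(* An undirected graph is a pair of its vertex set and its set of edges {u, v}. *)
type_synonym 'a ugraph = "'a set \<times> 'a set set"

definition verts :: "'a ugraph \<Rightarrow> 'a set" where
  "verts G = fst G"

definition edges :: "'a ugraph \<Rightarrow> 'a set set" where
  "edges G = snd G"

definition groupoid_graph :: "'a set \<Rightarrow> ('a \<Rightarrow> 'a \<Rightarrow> 'a) \<Rightarrow> 'a ugraph" where
  "groupoid_graph V f = (V, {{u, v} |u v. u \<in> V \<and> v \<in> V \<and> u \<noteq> f u v \<and> f u v = v})"

definition simple_travel_groupoids_on :: "'a ugraph \<Rightarrow> ('a \<Rightarrow> 'a \<Rightarrow> 'a) set" where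
  "simple_travel_groupoids_on G =
     {f. simple_travel_groupoid (verts G) f \<and> G = groupoid_graph (verts G) f}"

(* The graph with parts P 1, ..., P l; it is the complete multipartite graph when
   these parts are finite, nonempty and pairwise disjoint. *)
definition complete_multipartite :: "nat \<Rightarrow> (nat \<Rightarrow> 'a set) \<Rightarrow> 'a ugraph" where
  "complete_multipartite l P =
     (\<Union>p\<in>{1..l}. P p,
      {{u, v} |u v. \<exists>p\<in>{1..l}. \<exists>q\<in>{1..l}. p \<noteq> q \<and> u \<in> P p \<and> v \<in> P q})"

(* The coefficient N! / (\<Prod>i\<in>I. (m i)!); the natural-number division is exact
   when the m i sum to N, and it is only used in that case. *)
definition multinomial :: "nat \<Rightarrow> 'i set \<Rightarrow> ('i \<Rightarrow> nat) \<Rightarrow> nat" where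
  "multinomial N I m = fact N div (\<Prod>i\<in>I. fact (m i))"

(* The index set of the families (m_{q,j}) for a fixed p. *)
definition other_indices :: "nat \<Rightarrow> (nat \<Rightarrow> nat) \<Rightarrow> nat \<Rightarrow> (nat \<times> nat) set" where
  "other_indices l n p = (SIGMA q:{1..l} - {p}. {1..n q})"

(* Families indexed by I are extensional functions on I, so each family occurs once. *)
definition families_with_sum :: "'i set \<Rightarrow> nat \<Rightarrow> ('i \<Rightarrow> nat) set" where
  "families_with_sum I N = {m \<in> I \<rightarrow>\<^sub>E UNIV. (\<Sum>i\<in>I. m i) = N}"

end

theory Submission
  imports Defs
begin

text \<open>
  In a simple travel groupoid \<open>u * u = u\<close>, the element \<open>u * v\<close> is a neighbour of \<open>u\<close> whenever
  \<open>u \<noteq> v\<close>, and \<open>u * v = v\<close> exactly on the edges. If \<open>u\<close> and \<open>v\<close> are distinct vertices of the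
  same part, \<open>v * u\<close> lies in another part and so is a neighbour of \<open>u\<close> too; hence (t3) reads
  \<open>u * v = u * (v * u) = v * u\<close>. Thus the groupoid amounts to a choice, for every unordered pair of
  vertices in the same part, of a vertex outside that part, and every choice is admissible.
  Part \<open>p\<close> contributes \<open>d ^ (n p choose 2)\<close>, where \<open>d\<close> is the number of vertices outside it, and
  by the multinomial theorem the inner sums of the formula are the powers \<open>d ^ (n p - k)\<close>.
\<close>

section \<open>The multinomial theorem for the all-ones vector\<close>

lemma finite_families_with_sum:
  assumes "finite I"
  shows "finite (families_with_sum I N)"
proof (rule finite_subset)
  show "families_with_sum I N \<subseteq> I \<rightarrow>\<^sub>E {..N}"
  proof
    fix m assume m: "m \<in> families_with_sum I N"
    then have "m i \<le> N" if "i \<in> I" for i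
      using member_le_sum[OF that, of m] assms by (auto simp: families_with_sum_def)
    with m show "m \<in> I \<rightarrow>\<^sub>E {..N}"
      by (auto simp: families_with_sum_def PiE_iff)
  qed
qed (simp add: assms finite_PiE)

text \<open>This makes the natural-number division in \<open>multinomial\<close> exact. The
  induction merges one factorial at a time, since \<open>fact a * fact b\<close> divides
  \<open>fact (a + b)\<close>.\<close>

lemma prod_fact_dvd_fact_sum:
  fixes m :: "'i \<Rightarrow> nat"
  assumes "finite I"
  shows "(\<Prod>i\<in>I. fact (m i)) dvd (fact (\<Sum>i\<in>I. m i) :: nat)"
  using assms
proof (induction I rule: finite_induct)
  case (insert i I)
  have "fact (m i) * (\<Prod>i\<in>I. fact (m i)) dvd fact (m i) * (fact (\<Sum>i\<in>I. m i) :: nat)"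
    using insert.IH by (rule mult_dvd_mono[OF dvd_refl])
  also have "\<dots> dvd fact (m i + (\<Sum>i\<in>I. m i))"
    by (rule fact_fact_dvd_fact)
  finally show ?case
    using insert.hyps by simp
qed simp

text \<open>Splitting off the entry \<open>k\<close> at \<open>i\<close> leaves a family on
  \<open>I\<close> with sum \<open>N - k\<close>; this drives the induction on the index
  set.\<close>

lemma families_with_sum_insert:
  assumes "finite I" "i \<notin> I"
  shows "families_with_sum (insert i I) N =
    (\<lambda>(k, m). m(i := k)) ` (SIGMA k:{..N}. families_with_sum I (N - k))"
proof (intro equalityI subsetI)
  fix m assume m: "m \<in> families_with_sum (insert i I) N"
  \<comment> \<open>Resetting the entry at \<open>i\<close> to \<open>undefined\<close> makes the
    remaining family extensional on \<open>I\<close>.\<close>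
  have "(\<Sum>j\<in>I. (m(i := undefined)) j) = (\<Sum>j\<in>I. m j)"
    using assms by (intro sum.cong) auto
  then have "(m i, m(i := undefined)) \<in> (SIGMA k:{..N}. families_with_sum I (N - k))"
    using m assms by (auto simp: families_with_sum_def PiE_iff extensional_def)
  then show "m \<in> (\<lambda>(k, m). m(i := k)) ` (SIGMA k:{..N}. families_with_sum I (N - k))"
    by (rule rev_image_eqI) simp
next
  fix m' assume "m' \<in> (\<lambda>(k, m). m(i := k)) ` (SIGMA k:{..N}. families_with_sum I (N - k))"
  then obtain k m where m: "m' = m(i := k)" "k \<le> N" "m \<in> families_with_sum I (N - k)"
    by auto
  have "(\<Sum>j\<in>I. (m(i := k)) j) = (\<Sum>j\<in>I. m j)"
    using assms by (intro sum.cong) auto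
  then show "m' \<in> families_with_sum (insert i I) N"
    using m assms by (auto simp: families_with_sum_def PiE_iff extensional_def)
qed

lemma inj_on_fun_upd_families:
  assumes "i \<notin> I"
  shows "inj_on (\<lambda>(k, m). m(i := k)) (SIGMA k:{..N}. families_with_sum I (N - k))"
  unfolding families_with_sum_def
  by (rule inj_on_subset[OF inj_combinator[OF assms, of "\<lambda>_. UNIV"]]) auto

text \<open>Cancel \<open>fact (N - k)\<close> in N!/(k! Q) = N!/(k! (N-k)!) * (N-k)!/Q, where Q is
  the product of the factorials over \<open>I\<close>. The exact quotient \<open>c\<close> of
  \<open>fact (N - k)\<close> by Q justifies this for \<open>div\<close>.\<close>

lemma multinomial_insert:
  assumes "finite I" "i \<notin> I" "k \<le> N" "m \<in> families_with_sum I (N - k)"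
  shows "multinomial N (insert i I) (m(i := k)) = (N choose k) * multinomial (N - k) I m"
proof -
  let ?Q = "\<Prod>j\<in>I. fact (m j) :: nat"
  have "?Q dvd fact (N - k)"
    using prod_fact_dvd_fact_sum[of I m] assms by (simp add: families_with_sum_def)
  then obtain c where c: "fact (N - k) = ?Q * c" ..
  have prod: "(\<Prod>j\<in>insert i I. fact ((m(i := k)) j)) = fact k * ?Q"
  proof -
    have "(\<Prod>j\<in>I. fact ((m(i := k)) j)) = ?Q"
      using assms by (intro prod.cong) auto
    with assms show ?thesis by simp
  qed
  have Q: "?Q > 0"
    by (simp add: prod_pos)
  have "fact N = fact k * fact (N - k) * (N choose k)"
    using binomial_fact_lemma[OF \<open>k \<le> N\<close>] by simp
  also have "\<dots> = (fact k * ?Q) * ((N choose k) * c)"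
    by (simp add: c)
  finally have "multinomial N (insert i I) (m(i := k)) = (N choose k) * c"
    unfolding multinomial_def prod using Q by simp
  moreover have "multinomial (N - k) I m = c"
    unfolding multinomial_def c using Q by simp
  ultimately show ?thesis by simp
qed

text \<open>The multinomial theorem for (1 + ... + 1)^N. Summing over the entry at the new index
  turns the induction step into the binomial expansion of (1 + \<open>card I\<close>)^N.\<close>

lemma sum_multinomial:
  assumes "finite I"
  shows "(\<Sum>m\<in>families_with_sum I N. multinomial N I m) = card I ^ N"
  using assms
proof (induction I arbitrary: N rule: finite_induct)
  case empty
  \<comment> \<open>The only family on the empty set has sum 0, in agreement with
    \<open>0 ^ N\<close>, which is 1 exactly for \<open>N = 0\<close>.\<close>
  have "families_with_sum ({} :: 'a set) N = (if N = 0 then {\<lambda>_. undefined} else {})"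
    by (auto simp: families_with_sum_def)
  then show ?case
    by (simp add: multinomial_def)
next
  case (insert i I)
  have "(\<Sum>m\<in>families_with_sum (insert i I) N. multinomial N (insert i I) m) =
      (\<Sum>(k, m)\<in>(SIGMA k:{..N}. families_with_sum I (N - k)).
        multinomial N (insert i I) (m(i := k)))"
    unfolding families_with_sum_insert[OF insert.hyps]
    by (subst sum.reindex[OF inj_on_fun_upd_families[OF insert.hyps(2)]])
       (simp add: case_prod_unfold)
  also have "\<dots> = (\<Sum>k\<le>N. \<Sum>m\<in>families_with_sum I (N - k).
      multinomial N (insert i I) (m(i := k)))"
    using insert.hyps by (subst sum.Sigma) (auto simp: finite_families_with_sum)
  also have "\<dots> = (\<Sum>k\<le>N. (N choose k) * card I ^ (N - k))"
    using insert by (simp add: multinomial_insert flip: sum_distrib_left)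
  also have "\<dots> = (1 + card I) ^ N"
    using binomial[of 1 "card I" N] by simp
  finally show ?case
    using insert.hyps by simp
qed

section \<open>Simple travel groupoids\<close>

context simple_travel_groupoid
begin

lemma closed: "u \<in> V \<Longrightarrow> v \<in> V \<Longrightarrow> u \<star> v \<in> V"
  using op_closed by (auto simp: PiE_iff)

lemma op_neq: "u \<in> V \<Longrightarrow> v \<in> V \<Longrightarrow> u \<noteq> v \<Longrightarrow> u \<star> v \<noteq> u"
  using t2 by metis

text \<open>Put w = u * u. Then w * u = u by (t1), so (w * u) * u = u * u = w, and (t2) forces w =
  u.\<close>

lemma idem: "u \<in> V \<Longrightarrow> u \<star> u = u"
  using t1 t2 closed by metis

text \<open>Apply (t1) to the pair u * v, u and replace (u * v) * u by u.\<close>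

lemma op_op: "u \<in> V \<Longrightarrow> v \<in> V \<Longrightarrow> u \<star> (u \<star> v) = u \<star> v"
  using t1[of "u \<star> v" u] t1[of u v] closed by simp

text \<open>The condition is symmetric although edges are unordered: if u * v = v, then v * u = (u *
  v) * u = u by (t1).\<close>

lemma edge_iff:
  assumes "u \<in> V" "v \<in> V"
  shows "{u, v} \<in> edges (groupoid_graph V f) \<longleftrightarrow> u \<noteq> v \<and> u \<star> v = v"
  using assms t1 by (fastforce simp: edges_def groupoid_graph_def doubleton_eq_iff)

lemma edge_op:
  assumes "u \<in> V" "v \<in> V" "u \<noteq> v"
  shows "{u, u \<star> v} \<in> edges (groupoid_graph V f)"
  using assms edge_iff closed op_neq op_op by metis

text \<open>Here (t3) enters: adjacency of u and v * u gives v * u \<noteq> u and u * (v * u) = v *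
  u, so u * v = v * u.\<close>

lemma op_commute:
  assumes "u \<in> V" "v \<in> V" "u \<noteq> v" "{u, v \<star> u} \<in> edges (groupoid_graph V f)"
  shows "u \<star> v = v \<star> u"
  using assms edge_iff closed t3 by metis

end

section \<open>Graphs in which nonadjacent vertices are twins\<close>

definition nonedges :: "'a set \<Rightarrow> 'a set set \<Rightarrow> 'a set set" where
  "nonedges V E = {e. e \<subseteq> V \<and> card e = 2 \<and> e \<notin> E}"

definition common_neighbours :: "'a set \<Rightarrow> 'a set set \<Rightarrow> 'a set \<Rightarrow> 'a set" where
  "common_neighbours V E e = {w \<in> V. \<forall>u\<in>e. {u, w} \<in> E}"

text \<open>Since \<open>g\<close> takes the unordered pair, the operation commutes on nonadjacent
  vertices by construction; the restricted abstractions make it extensional.\<close>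

definition op_of_choice :: "'a set \<Rightarrow> 'a set set \<Rightarrow> ('a set \<Rightarrow> 'a) \<Rightarrow> 'a \<Rightarrow> 'a \<Rightarrow> 'a" where
  "op_of_choice V E g =
     (\<lambda>u\<in>V. \<lambda>v\<in>V. if u = v \<or> {u, v} \<in> E then v else g {u, v})"

text \<open>By symmetry, \<open>twins\<close> says that distinct nonadjacent vertices have equal
  neighbourhoods. This describes complete multipartite graphs without naming their parts.\<close>

locale twin_graph =
  fixes V :: "'a set" and E :: "'a set set"
  assumes V_nonempty: "V \<noteq> {}"
    and finite_V: "finite V"
    and E_subset: "E \<subseteq> {{u, v} |u v. u \<in> V \<and> v \<in> V \<and> u \<noteq> v}"
    and twins: "\<And>u v w. u \<in> V \<Longrightarrow> v \<in> V \<Longrightarrow> u \<noteq> v \<Longrightarrow> {u, v} \<notin> E \<Longrightarrow> {u, w} \<in> E \<Longrightarrow> {v, w} \<in> E"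
begin

lemma pair_nonedge:
  "u \<in> V \<Longrightarrow> v \<in> V \<Longrightarrow> u \<noteq> v \<Longrightarrow> {u, v} \<notin> E \<Longrightarrow> {u, v} \<in> nonedges V E"
  by (simp add: nonedges_def)

lemma nonedgeE:
  assumes "e \<in> nonedges V E"
  obtains u v where "e = {u, v}" "u \<in> V" "v \<in> V" "u \<noteq> v" "{u, v} \<notin> E"
  using assms by (auto simp: nonedges_def card_2_iff)

lemma edge_neq: "{u, v} \<in> E \<Longrightarrow> u \<noteq> v"
  using E_subset by (auto simp: doubleton_eq_iff)

lemma edge_in_V: "{u, v} \<in> E \<Longrightarrow> u \<in> V \<and> v \<in> V"
  using E_subset by (auto simp: doubleton_eq_iff)

lemma op_of_choice_in_simple_travel_groupoids:
  assumes g: "g \<in> (\<Pi>\<^sub>E e\<in>nonedges V E. common_neighbours V E e)"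
  shows "op_of_choice V E g \<in> simple_travel_groupoids_on (V, E)"
proof -
  let ?f = "op_of_choice V E g"
  have same: "?f u u = u" if "u \<in> V" for u
    using that by (simp add: op_of_choice_def)
  have adj: "?f u v = v" if "{u, v} \<in> E" for u v
    using that edge_in_V[OF that] by (simp add: op_of_choice_def)
  \<comment> \<open>Both orders of a nonadjacent pair give the same common neighbour w, so each
    axiom for the pair reduces to a product along an edge at w.\<close>
  have nonadj: "?f u v \<in> V \<and> {u, ?f u v} \<in> E \<and> {v, ?f u v} \<in> E \<and> ?f v u = ?f u v"
    if "u \<in> V" "v \<in> V" "u \<noteq> v" "{u, v} \<notin> E" for u v
    using PiE_mem[OF g pair_nonedge[OF that]] that
    by (auto simp: op_of_choice_def common_neighbours_def insert_commute)
  have closed: "?f u v \<in> V" if "u \<in> V" "v \<in> V" for u v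
    using that same[of u] adj[of u v] nonadj[of u v]
    by (cases "u = v"; cases "{u, v} \<in> E") simp_all
  have stg: "simple_travel_groupoid V ?f"
  proof
    show "V \<noteq> {}" by (rule V_nonempty)
    show "?f \<in> V \<rightarrow>\<^sub>E V \<rightarrow>\<^sub>E V"
      using closed by (auto simp: PiE_iff) (auto simp: op_of_choice_def)
  next
    fix u v assume uv: "u \<in> V" "v \<in> V"
    consider "u = v" | "{u, v} \<in> E" | "u \<noteq> v" "{u, v} \<notin> E" by blast
    then show "?f (?f u v) u = u"
    proof cases
      case 1 then show ?thesis using uv same by simp
    next
      case 2 then show ?thesis using adj[of u v] adj[of v u] by (simp add: insert_commute)
    next
      case 3 then show ?thesis
        using nonadj[of u v] adj[of "?f u v" u] uv by (simp add: insert_commute)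
    qed
  next
    fix u v assume uv: "u \<in> V" "v \<in> V" "?f (?f u v) v = u"
    consider "u = v" | "{u, v} \<in> E" | "u \<noteq> v" "{u, v} \<notin> E" by blast
    then show "u = v"
    proof cases
      case 2 then show ?thesis using uv adj[of u v] same[of v] by simp
    next
      case 3 then show ?thesis
        using nonadj[of u v] adj[of "?f u v" v] uv by (simp add: insert_commute)
    qed
  next
    fix u v assume uv: "u \<in> V" "v \<in> V" "?f v u \<noteq> u"
    consider "u = v" | "{u, v} \<in> E" | "u \<noteq> v" "{u, v} \<notin> E" by blast
    then show "?f u (?f v u) = ?f u v"
    proof cases
      case 1 then show ?thesis using uv same by simp
    next
      case 2 then show ?thesis using uv adj[of v u] by (simp add: insert_commute)
    next
      case 3 then show ?thesis
        using nonadj[of u v] adj[of u "?f u v"] uv by simp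
    qed
  qed
  have edge_iff: "u \<noteq> v \<and> ?f u v = v \<longleftrightarrow> {u, v} \<in> E" if "u \<in> V" "v \<in> V" for u v
    using that adj[of u v] nonadj[of u v] edge_neq[of u v] by metis
  have "E = {{u, v} |u v. u \<in> V \<and> v \<in> V \<and> u \<noteq> ?f u v \<and> ?f u v = v}" (is "_ = ?E")
  proof (intro equalityI subsetI)
    fix e assume "e \<in> E"
    moreover from this obtain u v where "e = {u, v}" "u \<in> V" "v \<in> V"
      using E_subset by blast
    ultimately show "e \<in> ?E"
      using edge_iff by fastforce
  next
    fix e assume "e \<in> ?E"
    then show "e \<in> E"
      using edge_iff by fastforce
  qed
  with stg show ?thesis
    by (simp add: simple_travel_groupoids_on_def verts_def groupoid_graph_def)
qed

lemma inj_on_op_of_choice: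
  "inj_on (op_of_choice V E) (\<Pi>\<^sub>E e\<in>nonedges V E. common_neighbours V E e)"
proof (rule inj_onI)
  fix g h
  assume g: "g \<in> (\<Pi>\<^sub>E e\<in>nonedges V E. common_neighbours V E e)"
    and h: "h \<in> (\<Pi>\<^sub>E e\<in>nonedges V E. common_neighbours V E e)"
    and eq: "op_of_choice V E g = op_of_choice V E h"
  show "g = h"
  proof (rule PiE_ext[OF g h])
    fix e assume "e \<in> nonedges V E"
    then obtain u v where e: "e = {u, v}" "u \<in> V" "v \<in> V" "u \<noteq> v" "{u, v} \<notin> E"
      by (rule nonedgeE)
    then show "g e = h e"
      using fun_cong[OF fun_cong[OF eq, of u], of v] by (simp add: op_of_choice_def)
  qed
qed

lemma simple_travel_groupoid_is_op_of_choice: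
  assumes "f \<in> simple_travel_groupoids_on (V, E)"
  obtains g where "g \<in> (\<Pi>\<^sub>E e\<in>nonedges V E. common_neighbours V E e)"
    and "f = op_of_choice V E g"
proof -
  interpret simple_travel_groupoid V f
    using assms by (simp add: simple_travel_groupoids_on_def verts_def)
  have "groupoid_graph V f = (V, E)"
    using assms unfolding simple_travel_groupoids_on_def verts_def fst_conv
    by (elim CollectE conjE) (rule sym)
  then have E: "edges (groupoid_graph V f) = E"
    unfolding edges_def by (rule ssubst) (rule snd_conv)
  note edge_iff = edge_iff[unfolded E] and edge_op = edge_op[unfolded E]
    and op_commute = op_commute[unfolded E]
  \<comment> \<open>The vertex v * u is adjacent to v, hence to its twin u, so
    \<open>op_commute\<close> applies.\<close>
  have commute: "f u v = f v u" if "u \<in> V" "v \<in> V" "u \<noteq> v" "{u, v} \<notin> E" for u v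
    using that edge_op[of v u] twins[of v u "f v u"] op_commute[of u v]
    by (simp add: insert_commute)
  \<comment> \<open>One value has to serve both orderings of the pair, which commutativity provides.
    It is adjacent to u by \<open>edge_op\<close> and to v by \<open>twins\<close>.\<close>
  have "\<exists>w. w \<in> common_neighbours V E e \<and> (\<forall>u v. e = {u, v} \<longrightarrow> f u v = w)"
    if mem: "e \<in> nonedges V E" for e
  proof -
    obtain u v where e: "e = {u, v}" "u \<in> V" "v \<in> V" "u \<noteq> v" "{u, v} \<notin> E"
      using mem by (rule nonedgeE)
    have "{u, f u v} \<in> E" "{v, f u v} \<in> E"
      using e edge_op[of u v] twins[of u v "f u v"] by simp_all
    with e closed[of u v] commute[of u v] show ?thesis
      by (auto simp: common_neighbours_def doubleton_eq_iff)
  qed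
  then obtain g where g: "\<And>e. e \<in> nonedges V E \<Longrightarrow>
      g e \<in> common_neighbours V E e \<and> (\<forall>u v. e = {u, v} \<longrightarrow> f u v = g e)"
    by metis
  have f_eq: "f u v = g {u, v}" if "{u, v} \<in> nonedges V E" for u v
    using g[OF that] by blast
  let ?g = "restrict g (nonedges V E)"
  have "f = op_of_choice V E ?g"
  proof (rule PiE_ext[OF op_closed])
    show "op_of_choice V E ?g \<in> V \<rightarrow>\<^sub>E V \<rightarrow>\<^sub>E V"
    proof -
      have "g e \<in> V" if "e \<in> nonedges V E" for e
        using g[OF that] by (simp add: common_neighbours_def)
      then show ?thesis
        using pair_nonedge by (auto simp: op_of_choice_def PiE_iff extensional_def)
    qed
    fix u assume u: "u \<in> V"
    show "f u = op_of_choice V E ?g u"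
    proof
      fix v
      show "f u v = op_of_choice V E ?g u v"
      proof (cases "v \<in> V")
        case True
        consider "u = v" | "{u, v} \<in> E" | "u \<noteq> v" "{u, v} \<notin> E"
          by blast
        then show ?thesis
        proof cases
          case 1
          then show ?thesis using u idem[of u] by (simp add: op_of_choice_def)
        next
          case 2
          then have "f u v = v" using edge_iff[OF u True] by blast
          then show ?thesis using u True 2 by (simp add: op_of_choice_def)
        next
          case 3
          then have "{u, v} \<in> nonedges V E" using pair_nonedge u True by blast
          then have "f u v = ?g {u, v}" using f_eq by simp
          then show ?thesis using u True 3 by (simp add: op_of_choice_def)
        qed
      next
        case False
        have "f u \<in> V \<rightarrow>\<^sub>E V"
          using op_closed u by (rule PiE_mem)
        then have "f u v = undefined"
          using False by (rule PiE_arb)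
        then show ?thesis
          using u False by (simp add: op_of_choice_def)
      qed
    qed
  qed
  moreover have "?g \<in> (\<Pi>\<^sub>E e\<in>nonedges V E. common_neighbours V E e)"
    using g by simp
  ultimately show thesis
    using that by blast
qed

text \<open>\<open>op_of_choice\<close> is a bijection from the choice functions on nonedges, so the
  count is the cardinality of a dependent product.\<close>

theorem card_simple_travel_groupoids_on:
  "card (simple_travel_groupoids_on (V, E)) =
    (\<Prod>e\<in>nonedges V E. card (common_neighbours V E e))"
proof -
  have "simple_travel_groupoids_on (V, E) =
      op_of_choice V E ` (\<Pi>\<^sub>E e\<in>nonedges V E. common_neighbours V E e)"
    using op_of_choice_in_simple_travel_groupoids simple_travel_groupoid_is_op_of_choice by blast
  then have "card (simple_travel_groupoids_on (V, E)) =
      card (\<Pi>\<^sub>E e\<in>nonedges V E. common_neighbours V E e)"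
    by (simp add: card_image inj_on_op_of_choice)
  also have "\<dots> = (\<Prod>e\<in>nonedges V E. card (common_neighbours V E e))"
    by (rule card_PiE) (simp add: nonedges_def finite_V)
  finally show ?thesis .
qed

end

section \<open>Complete multipartite graphs\<close>

locale multipartition =
  fixes l :: nat and P :: "nat \<Rightarrow> 'a set"
  assumes l_pos: "1 \<le> l"
    and disjoint: "disjoint_family_on P {1..l}"
    and finite_part: "\<And>p. p \<in> {1..l} \<Longrightarrow> finite (P p)"
    and part_nonempty: "\<And>p. p \<in> {1..l} \<Longrightarrow> P p \<noteq> {}"
begin

definition carrier :: "'a set" where
  "carrier = (\<Union>p\<in>{1..l}. P p)"

definition edge_set :: "'a set set" where
  "edge_set = edges (complete_multipartite l P)"

lemma part_unique: "p \<in> {1..l} \<Longrightarrow> q \<in> {1..l} \<Longrightarrow> u \<in> P p \<Longrightarrow> u \<in> P q \<Longrightarrow> p = q"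
  using disjoint unfolding disjoint_family_on_def by blast

lemma part_subset: "p \<in> {1..l} \<Longrightarrow> P p \<subseteq> carrier"
  by (auto simp: carrier_def)

text \<open>The neighbourhood of a vertex depends only on its part; this yields \<open>twins\<close>
  and identifies the nonedges and their common neighbours.\<close>

lemma edge_iff:
  assumes "p \<in> {1..l}" "u \<in> P p"
  shows "{u, w} \<in> edge_set \<longleftrightarrow> w \<in> carrier - P p"
proof
  assume "{u, w} \<in> edge_set"
  then obtain q r where "q \<in> {1..l}" "r \<in> {1..l}" "q \<noteq> r" "u \<in> P q" "w \<in> P r"
    by (auto simp: edge_set_def edges_def complete_multipartite_def doubleton_eq_iff)
  moreover from this have "q = p"
    using assms part_unique by blast
  ultimately show "w \<in> carrier - P p"
    using assms part_unique part_subset by blast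
next
  assume "w \<in> carrier - P p"
  then obtain q where "q \<in> {1..l}" "w \<in> P q" "q \<noteq> p"
    unfolding carrier_def by blast
  then show "{u, w} \<in> edge_set"
    using assms unfolding edge_set_def edges_def complete_multipartite_def snd_conv by blast
qed

sublocale twin_graph carrier edge_set
proof
  show "carrier \<noteq> {}" "finite carrier"
    using l_pos part_nonempty[of 1] finite_part by (auto simp: carrier_def)
  show "edge_set \<subseteq> {{u, v} |u v. u \<in> carrier \<and> v \<in> carrier \<and> u \<noteq> v}"
    using part_unique
    by (fastforce simp: edge_set_def edges_def complete_multipartite_def carrier_def)
  fix u v w
  assume "u \<in> carrier" "v \<in> carrier" "{u, v} \<notin> edge_set" "{u, w} \<in> edge_set"
  moreover from \<open>u \<in> carrier\<close> obtain p where "p \<in> {1..l}" "u \<in> P p"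
    by (auto simp: carrier_def)
  ultimately show "{v, w} \<in> edge_set"
    using edge_iff by auto
qed

lemma nonedges_eq:
  "nonedges carrier edge_set = (\<Union>p\<in>{1..l}. {e. e \<subseteq> P p \<and> card e = 2})"
proof (intro equalityI subsetI)
  fix e assume "e \<in> nonedges carrier edge_set"
  then obtain u v where e: "e = {u, v}" "u \<in> carrier" "v \<in> carrier" "u \<noteq> v" "{u, v} \<notin> edge_set"
    by (rule nonedgeE)
  then obtain p where "p \<in> {1..l}" "u \<in> P p"
    by (auto simp: carrier_def)
  with e edge_iff[of p u v] show "e \<in> (\<Union>p\<in>{1..l}. {e. e \<subseteq> P p \<and> card e = 2})"
    by auto
next
  fix e assume "e \<in> (\<Union>p\<in>{1..l}. {e. e \<subseteq> P p \<and> card e = 2})"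
  then obtain p u v where "p \<in> {1..l}" "e = {u, v}" "u \<noteq> v" "u \<in> P p" "v \<in> P p"
    by (auto simp: card_2_iff)
  then show "e \<in> nonedges carrier edge_set"
    using edge_iff[of p u v] part_subset[of p] by (auto simp: nonedges_def)
qed

lemma common_neighbours_eq:
  assumes "p \<in> {1..l}" "e \<subseteq> P p" "e \<noteq> {}"
  shows "common_neighbours carrier edge_set e = carrier - P p"
  using assms edge_iff[OF assms(1)] by (auto simp: common_neighbours_def)

theorem card_simple_travel_groupoids_on_multipartite:
  "card (simple_travel_groupoids_on (complete_multipartite l P)) =
    (\<Prod>p = 1..l. card (carrier - P p) ^ (card (P p) choose 2))"
proof -
  let ?D = "\<lambda>p. {e. e \<subseteq> P p \<and> card e = 2}"
  have "complete_multipartite l P = (carrier, edge_set)"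
    by (simp add: carrier_def edge_set_def edges_def complete_multipartite_def)
  then have "card (simple_travel_groupoids_on (complete_multipartite l P)) =
      (\<Prod>e\<in>(\<Union>p\<in>{1..l}. ?D p). card (common_neighbours carrier edge_set e))"
    by (simp add: card_simple_travel_groupoids_on nonedges_eq)
  also have "\<dots> = (\<Prod>p = 1..l. \<Prod>e\<in>?D p. card (common_neighbours carrier edge_set e))"
  proof (rule prod.UNION_disjoint)
    show "\<forall>p\<in>{1..l}. finite (?D p)"
      using finite_part by simp
    show "\<forall>p\<in>{1..l}. \<forall>q\<in>{1..l}. p \<noteq> q \<longrightarrow> ?D p \<inter> ?D q = {}"
      using part_unique by (fastforce simp: card_2_iff)
  qed simp
  also have "\<dots> = (\<Prod>p = 1..l. \<Prod>e\<in>?D p. card (carrier - P p))"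
    by (intro prod.cong refl arg_cong[where f = card] common_neighbours_eq) auto
  also have "\<dots> = (\<Prod>p = 1..l. card (carrier - P p) ^ (card (P p) choose 2))"
    using finite_part by (simp add: n_subsets)
  finally show ?thesis .
qed

text \<open>The indices of the summation variables for \<open>p\<close> correspond in number to the
  vertices outside part \<open>p\<close>, hence the base of the power.\<close>

lemma card_carrier_minus_part:
  assumes "p \<in> {1..l}" "\<And>q. q \<in> {1..l} \<Longrightarrow> card (P q) = n q"
  shows "card (carrier - P p) = card (other_indices l n p)"
proof -
  have "carrier - P p = (\<Union>q\<in>{1..l} - {p}. P q)"
    using assms(1) part_unique by (auto simp: carrier_def)
  also have "card \<dots> = (\<Sum>q\<in>{1..l} - {p}. card (P q))"
    using finite_part part_unique by (intro card_UN_disjoint) auto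
  also have "\<dots> = card (other_indices l n p)"
    using assms by (simp add: other_indices_def)
  finally show ?thesis .
qed

end

section \<open>Evaluation of the product formula\<close>

text \<open>The exponents run through N-1, ..., 0. For \<open>d = 0\<close>, which arises when there
  is a single part, the factor \<open>0 ^ 0 = 1\<close> at \<open>k = N\<close> matters: the product
  is 1 for \<open>N = 1\<close> and 0 for larger \<open>N\<close>.\<close>

lemma prod_power_choose_two:
  fixes d :: nat
  shows "(\<Prod>k = 1..N. d ^ (N - k)) = d ^ (N choose 2)"
proof -
  have "(\<Prod>k = 1..N. d ^ (N - k)) = d ^ (\<Sum>k = 1..N. N - k)"
    by (simp add: power_sum)
  also have "(\<Sum>k = 1..N. N - k) = (\<Sum>k<N. k)"
    by (rule sum.reindex_bij_witness[of _ "\<lambda>k. N - k" "\<lambda>k. N - k"]) auto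
  also have "\<dots> = N choose 2"
    by (induction N) (simp_all add: numeral_2_eq_2)
  finally show ?thesis .
qed

theorem theorem5p3:
  fixes l :: nat and P :: "nat \<Rightarrow> 'a set" and n :: "nat \<Rightarrow> nat" and G :: "'a ugraph"
  assumes "1 \<le> l"
    and "disjoint_family_on P {1..l}"
    and "\<And>p. p \<in> {1..l} \<Longrightarrow> finite (P p)"
    and "\<And>p. p \<in> {1..l} \<Longrightarrow> card (P p) = n p"
    and "\<And>p. p \<in> {1..l} \<Longrightarrow> 1 \<le> n p"
    and "G = complete_multipartite l P"
  shows "card (simple_travel_groupoids_on G) =
    (\<Prod>p = 1..l. \<Prod>k = 1..n p.
       \<Sum>m \<in> families_with_sum (other_indices l n p) (n p - k).
         multinomial (n p - k) (other_indices l n p) m)"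
proof -
  interpret multipartition l P
    by standard (use assms in force)+
  have "finite (other_indices l n p)" for p
    by (simp add: other_indices_def)
  \<comment> \<open>By \<open>sum_multinomial\<close> the k-th factor is d^(n p - k), with d the
    number of vertices outside part \<open>p\<close>. Deleting \<open>One_nat_def\<close> keeps the
    lower bound \<open>1\<close>, so that \<open>prod_power_choose_two\<close> matches.\<close>
  then have "(\<Prod>k = 1..n p. \<Sum>m \<in> families_with_sum (other_indices l n p) (n p - k).
      multinomial (n p - k) (other_indices l n p) m) =
    card (carrier - P p) ^ (card (P p) choose 2)" if "p \<in> {1..l}" for p
    using that assms(4) card_carrier_minus_part[OF that assms(4)]
    by (simp add: sum_multinomial prod_power_choose_two del: One_nat_def)
  then show ?thesis
    unfolding assms(6) card_simple_travel_groupoids_on_multipartite by simp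
qed

end
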